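(* Consider any of the Wallach spaces $\operatorname{SU}(3)/T_{\max}$, $\operatorname{Sp}(3)/\operatorname{Sp}(1)\times\operatorname{Sp}(1)\times\operatorname{Sp}(1)$, $F_4/\operatorname{Spin}(8)$ (parameter $a=1/6,\,1/8,\,1/9$ respectively). Let $\Sigma S$, $s_1,s_2,s_3$ and $I_1,I_2,I_3$ be the sets defined in the context. Then the following assertions hold for all indices with $\{i,j,k\}=\{1,2,3\}$. (1) The set $\Sigma S$ of invariant Riemannian metrics which belong to $\Sigma$ and admit positive sectional curvature is bounded in $\Sigma$ by the curves $s_1,s_2,s_3$ (that is, the topological boundary of $\Sigma S$ relative to $\Sigma$ is $s_1\cup s_2\cup s_3$). The sets $s_1,s_2,s_3$ are pairwise disjoint regular (smooth) space curves in $\Sigma$, and each $s_k$ is connected and can be parameterized as $$x_k=t^{-1}\alpha^{-2},\qquad x_i=t\alpha,\qquad x_j=\alpha,$$ where $$\alpha=\alpha(t):=\left(\frac{-t-1+2\sqrt{t^2-t+1}}{t(t-1)^2}\right)^{1/3}>0,\qquad t\in(0,1)\cup(1,+\infty),$$ and $\alpha$ is extended by continuity to $t=1$ by $\alpha(1):=\sqrt[3]{6}/2$. (2) Every invariant curve $I_k$, given by $x_i=x_j=p$, $x_k=p^{-2}$, $p>0$, intersects among $s_1,s_2,s_3$ only the curve $s_k$, and it does so at the unique point with coordinates $x_i=x_j=p_0$, $x_k=p_0^{-2}$, where $p_0=\sqrt[3]{6}/2$. Moreover $I_k$ approaches the other two curves $s_i$ and $s_j$ at infinity as close as we like, i.e.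 the distance from the point of $I_k$ with parameter $p$ to $s_i$, and to $s_j$, tends to $0$ as $p\to+\infty$.
   Context: Invariant Riemannian metrics on a Wallach space $G/H$ are identified with triples $(x_1,x_2,x_3)\in(0,+\infty)^3$ via $(\cdot,\cdot)=x_1\langle\cdot,\cdot\rangle|_{\mathfrak p_1}+x_2\langle\cdot,\cdot\rangle|_{\mathfrak p_2}+x_3\langle\cdot,\cdot\rangle|_{\mathfrak p_3}$, where $\langle\cdot,\cdot\rangle=-B$ is the negative of the Killing form of $\mathfrak g$ and $\mathfrak p=\mathfrak p_1\oplus\mathfrak p_2\oplus\mathfrak p_3$ is the decomposition of the orthogonal complement of $\mathfrak h$ in $\mathfrak g$ into three irreducible $\operatorname{Ad}(H)$-modules. For $\{i,j,k\}=\{1,2,3\}$ put $$\gamma_i:=(x_j-x_k)^2+2x_i(x_j+x_k)-3x_i^2 .$$ The set $S$ of metrics of positive sectional curvature is, by definition here (following the known description by Valiev used in the paper), $S:=\{(x_1,x_2,x_3)\in(0,+\infty)^3:\gamma_1>0,\gamma_2>0,\gamma_3>0\}$; it is the same set for all three Wallach spaces. Let $\Gamma_i:=\{x\in(0,+\infty)^3:\gamma_i=0\}$, $\Sigma:=\{x\in(0,+\infty)^3: x_1x_2x_3=1\}$, $s_i:=\Sigma\cap\Gamma_i$, $\Sigma S:=\Sigma\cap S$. The normalized Ricci flow on these spaces reduces to the system $$\frac{dx_i}{dt}=f_i(x_1,x_2,x_3):=\frac{x_i}{x_j}+\frac{x_i}{x_k}+2a\left(\frac{x_j}{x_k}+\frac{x_k}{x_j}-2\frac{x_i^2}{x_jx_k}\right)-2,\qquad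 \{i,j,k\}=\{1,2,3\},$$ for which the surface $\Sigma$ and the curves $I_k:=\{x\in\Sigma: x_i=x_j=p,\ x_k=p^{-2},\ p>0\}$ are invariant. *)

theory Defs
  imports "HOL-Analysis.Analysis"
begin

text \<open>Invariant metrics are triples in the open positive octant of \<open>real^3\<close>.  Indices live in the
  type \<open>3\<close>, whose arithmetic is modulo 3 (so \<open>{1,2,3} = UNIV\<close> and \<open>3 + 1 = 1\<close>); the two indices
  other than \<open>i\<close> are therefore \<open>i + 1\<close> and \<open>i + 2\<close>.  The formulas below are symmetric in these two,
  as the lemmas \<open>gamma_poly_eq\<close> and \<open>ricci_field_eq\<close> confirm.\<close>

definition metrics :: "(real^3) set" where
  "metrics = {x. \<forall>i. x $ i > 0}"

definition gamma_poly :: "3 \<Rightarrow> real^3 \<Rightarrow> real" where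
  "gamma_poly i x = (let j = i + 1; k = i + 2 in
     (x$j - x$k)^2 + 2 * x$i * (x$j + x$k) - 3 * (x$i)^2)"

definition pos_curv_metrics :: "(real^3) set" where
  "pos_curv_metrics = {x \<in> metrics. \<forall>i. gamma_poly i x > 0}"

definition Gamma_set :: "3 \<Rightarrow> (real^3) set" where
  "Gamma_set i = {x \<in> metrics. gamma_poly i x = 0}"

definition unit_volume :: "(real^3) set" where
  "unit_volume = {x \<in> metrics. x$1 * x$2 * x$3 = 1}"

definition s_curve :: "3 \<Rightarrow> (real^3) set" where
  "s_curve i = unit_volume \<inter> Gamma_set i"

definition unit_volume_pos_curv :: "(real^3) set" where
  "unit_volume_pos_curv = unit_volume \<inter> pos_curv_metrics"

definition ricci_field :: "real \<Rightarrow> real^3 \<Rightarrow> real^3" where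
  "ricci_field a x = (\<chi> i. let j = i + 1; k = i + 2 in
     x$i / x$j + x$i / x$k
       + 2 * a * (x$j / x$k + x$k / x$j - 2 * (x$i)^2 / (x$j * x$k)) - 2)"

definition ricci_solution :: "real \<Rightarrow> (real \<Rightarrow> real^3) \<Rightarrow> real set \<Rightarrow> bool" where
  "ricci_solution a x T \<longleftrightarrow> is_interval T \<and>
     (\<forall>t\<in>T. x t \<in> metrics \<and> (x has_vector_derivative ricci_field a (x t)) (at t within T))"

definition ricci_invariant :: "real \<Rightarrow> (real^3) set \<Rightarrow> bool" where
  "ricci_invariant a M \<longleftrightarrow>
     (\<forall>x T. ricci_solution a x T \<longrightarrow> (\<exists>t\<in>T. x t \<in> M) \<longrightarrow> (\<forall>t\<in>T. x t \<in> M))"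

definition I_point :: "3 \<Rightarrow> real \<Rightarrow> real^3" where
  "I_point k p = (\<chi> m. if m = k then 1 / p^2 else p)"

definition I_curve :: "3 \<Rightarrow> (real^3) set" where
  "I_curve k = {x \<in> unit_volume. \<exists>p>0. x = I_point k p}"

text \<open>\<open>C\<^sup>\<infinity>\<close> curves: \<open>D n\<close> is the \<open>n\<close>-th derivative of \<open>c\<close> on \<open>T\<close>.\<close>

definition smooth_curve_on :: "(real \<Rightarrow> 'a::real_normed_vector) \<Rightarrow> real set \<Rightarrow> bool" where
  "smooth_curve_on c T \<longleftrightarrow> (\<exists>D :: nat \<Rightarrow> real \<Rightarrow> 'a. D 0 = c \<and>
     (\<forall>n. \<forall>t\<in>T. (D n has_vector_derivative D (Suc n) t) (at t within T)))"

definition regular_parametrization ::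
    "(real \<Rightarrow> 'a::real_normed_vector) \<Rightarrow> real set \<Rightarrow> 'a set \<Rightarrow> bool" where
  "regular_parametrization c T C \<longleftrightarrow>
     open T \<and> is_interval T \<and> smooth_curve_on c T \<and>
     (\<forall>t\<in>T. vector_derivative c (at t) \<noteq> 0) \<and> (\<exists>g. homeomorphism T C c g)"

text \<open>A regular smooth curve as a point set: locally the homeomorphic image of an open interval
  under a smooth immersion, i.e. an embedded one-dimensional submanifold.\<close>

definition regular_curve :: "'a::real_normed_vector set \<Rightarrow> bool" where
  "regular_curve C \<longleftrightarrow>
     (\<forall>x\<in>C. \<exists>U T c. open U \<and> x \<in> U \<and> regular_parametrization c T (C \<inter> U))"

definition alpha :: "real \<Rightarrow> real" where
  "alpha t = (if t = 1 then root 3 6 / 2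
     else root 3 ((- t - 1 + 2 * sqrt (t^2 - t + 1)) / (t * (t - 1)^2)))"

text \<open>The parametrization of \<open>s_curve k\<close>, where \<open>k\<close> is the index other than \<open>i\<close> and \<open>j\<close>.\<close>

definition s_param :: "3 \<Rightarrow> 3 \<Rightarrow> real \<Rightarrow> real^3" where
  "s_param i j t = (\<chi> m. if m = i then t * alpha t else if m = j then alpha t
                         else 1 / (t * (alpha t)^2))"

lemma index_cases:
  fixes i j k :: 3
  assumes "{i, j, k} = {1, 2, 3}"
  shows "(j = i + 1 \<and> k = i + 2) \<or> (j = i + 2 \<and> k = i + 1)"
proof -
  have distinct: "i \<noteq> j" "i \<noteq> k" "j \<noteq> k"
    using arg_cong[OF assms, of card] by (auto simp: card_insert_if split: if_splits)
  show ?thesis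
    using exhaust_3[of i] exhaust_3[of j] exhaust_3[of k] distinct by auto
qed

lemma gamma_poly_eq:
  assumes "{i, j, k} = {1, 2, 3}"
  shows "gamma_poly i x = (x$j - x$k)^2 + 2 * x$i * (x$j + x$k) - 3 * (x$i)^2"
  using index_cases[OF assms]
  by (auto simp: gamma_poly_def Let_def power2_eq_square algebra_simps)

lemma ricci_field_eq:
  assumes "{i, j, k} = {1, 2, 3}"
  shows "ricci_field a x $ i = x$i / x$j + x$i / x$k
           + 2 * a * (x$j / x$k + x$k / x$j - 2 * (x$i)^2 / (x$j * x$k)) - 2"
  using index_cases[OF assms]
  by (auto simp: ricci_field_def Let_def algebra_simps)

end

theory Submission
  imports Defs
begin

text \<open>Three facts about the quadratic forms \<open>\<gamma>\<^sub>i\<close> carry the proof.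

  First, at most one \<open>\<gamma>\<^sub>i\<close> can be nonpositive at a positive triple
  (\<open>gamma_poly_pos_if_other_nonpos\<close>).  So the three boundary curves are disjoint.  Moreover, at a
  point of \<open>s\<^sub>k\<close> only the sign of \<open>\<gamma>\<^sub>k\<close> is critical, and the volume-preserving deformation
  \<open>(s x\<^sub>i, s x\<^sub>j, x\<^sub>k / s\<^sup>2)\<close> with \<open>s > 1\<close> makes it positive.  Hence every point of \<open>s\<^sub>k\<close> is a limit of
  positively curved metrics, and the boundary is exactly the union of the three curves.

  Second, as a polynomial in \<open>x\<^sub>k\<close> the form \<open>\<gamma>\<^sub>k\<close> has a single positive root, and it is homogeneous.
  So \<open>\<gamma>\<^sub>k = 0\<close> says that \<open>x\<^sub>k / x\<^sub>j\<close> is a fixed function (\<open>top_ratio\<close>) of \<open>t = x\<^sub>i / x\<^sub>j\<close>, and the unit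
  volume condition then determines \<open>x\<^sub>j = \<alpha>(t)\<close>.  This is the parametrization of \<open>s\<^sub>k\<close>.  Its inverse
  is \<open>x \<mapsto> x\<^sub>i / x\<^sub>j\<close>, which is continuous, and in these terms \<open>\<alpha>\<close> has no exceptional value at
  \<open>t = 1\<close>.  All its components lie in an algebra of functions closed under differentiation, so they
  are smooth.

  Third, along the Ricci flow the volume is constant and \<open>x\<^sub>i - x\<^sub>j\<close> satisfies a homogeneous linear
  equation.  A solution that meets \<open>x\<^sub>i = x\<^sub>j\<close> therefore stays there, which is the invariance of
  \<open>I\<^sub>k\<close>.  On \<open>I\<^sub>k\<close> the forms \<open>\<gamma>\<^sub>i\<close> and \<open>\<gamma>\<^sub>j\<close> reduce to \<open>x\<^sub>k\<^sup>2 > 0\<close>, and \<open>\<gamma>\<^sub>k\<close> vanishes only when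
  \<open>4 p\<^sup>3 = 3\<close>.  For large \<open>p\<close> the point of \<open>s\<^sub>i\<close> with ratio \<open>x\<^sub>k / x\<^sub>j = p\<^sup>-\<^sup>3\<close> is within \<open>3 / p\<^sup>2\<close>
  of the point of \<open>I\<^sub>k\<close> with parameter \<open>p\<close>, which gives the asymptotic statement.\<close>

section \<open>Index triples\<close>

lemma index_distinct:
  fixes i j k :: 3
  assumes "{i, j, k} = {1, 2, 3}"
  shows "i \<noteq> j" "j \<noteq> i" "i \<noteq> k" "k \<noteq> i" "j \<noteq> k" "k \<noteq> j"
  using arg_cong[OF assms, of card] by (auto simp: card_insert_if split: if_splits)

lemma index_univ:
  fixes i j k :: 3
  assumes "{i, j, k} = {1, 2, 3}"
  shows "UNIV = {i, j, k}"
  using assms UNIV_3 by auto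

lemma index_exhaust:
  fixes i j k :: 3
  assumes "{i, j, k} = {1, 2, 3}"
  shows "m = i \<or> m = j \<or> m = k"
  using index_univ[OF assms] by auto

lemma index_permute:
  fixes i j k :: 3
  assumes "{i, j, k} = {1, 2, 3}"
  shows "{i, k, j} = {1, 2, 3}" "{j, i, k} = {1, 2, 3}" "{j, k, i} = {1, 2, 3}"
    "{k, i, j} = {1, 2, 3}" "{k, j, i} = {1, 2, 3}"
  using assms by (metis insert_commute)+

lemma index_triple: "{m + 1, m + 2, m} = {1, 2, 3 :: 3}"
  using exhaust_3[of m] by auto

lemma unit_volume_iff:
  assumes "{i, j, k} = {1, 2, 3}"
  shows "x \<in> unit_volume \<longleftrightarrow> x $ i > 0 \<and> x $ j > 0 \<and> x $ k > 0 \<and> x $ i * x $ j * x $ k = 1"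
proof -
  have "x $ 1 * x $ 2 * x $ 3 = x $ i * x $ j * x $ k"
    using arg_cong[OF assms, of "prod (\<lambda>m. x $ m)"] index_distinct[OF assms] by (simp add: mult_ac)
  moreover have "x \<in> metrics \<longleftrightarrow> x $ i > 0 \<and> x $ j > 0 \<and> x $ k > 0"
    using index_exhaust[OF assms] unfolding metrics_def by auto metis
  ultimately show ?thesis
    by (auto simp: unit_volume_def)
qed

section \<open>The boundary of the positively curved metrics\<close>

lemma continuous_on_gamma_poly: "continuous_on S (gamma_poly i)"
  unfolding gamma_poly_def Let_def by (intro continuous_intros)

text \<open>The sum \<open>\<gamma>\<^sub>i + \<gamma>\<^sub>k\<close> equals \<open>2 (x\<^sub>j\<^sup>2 - (x\<^sub>i - x\<^sub>k)\<^sup>2)\<close>.  If both forms were nonpositive, one of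
  \<open>x\<^sub>i\<close>, \<open>x\<^sub>k\<close> would be at least the sum of the two other coordinates, and then the form belonging to
  the smaller of the two would be positive.\<close>

lemma gamma_poly_pos_if_other_nonpos:
  assumes ijk: "{i, j, k} = {1, 2, 3}" and x: "x \<in> metrics" and gk: "gamma_poly k x \<le> 0"
  shows "gamma_poly i x > 0"
proof (rule ccontr)
  assume gi: "\<not> ?thesis"
  note kij = index_permute(4)[OF ijk]
  have pos: "x $ i > 0" "x $ j > 0" "x $ k > 0" using x by (auto simp: metrics_def)
  note g = gamma_poly_eq[OF ijk, of x] gamma_poly_eq[OF kij, of x]
  have "(x$j)^2 \<le> (x$i - x$k)^2"
    using gk gi unfolding g by (simp add: power2_eq_square algebra_simps)
  hence "x$j \<le> \<bar>x$i - x$k\<bar>"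
    using pos by (simp add: abs_le_square_iff[symmetric])
  then consider "x$i \<ge> x$j + x$k" | "x$k \<ge> x$i + x$j" by linarith
  thus False
  proof cases
    case 1
    have "x$k * x$k \<le> (x$i - x$j) * (x$i - x$j)" using 1 pos by (intro mult_mono) auto
    moreover have "2 * x$k * (x$k + 2 * x$j) \<le> 2 * x$k * (x$i + x$j)"
      using 1 pos by (intro mult_left_mono) auto
    moreover have "x$k * x$j > 0" using pos by simp
    ultimately show False
      using gk unfolding g by (simp add: power2_eq_square algebra_simps)
  next
    case 2
    have "x$i * x$i \<le> (x$k - x$j) * (x$k - x$j)" using 2 pos by (intro mult_mono) auto
    moreover have "2 * x$i * (x$i + 2 * x$j) \<le> 2 * x$i * (x$k + x$j)"
      using 2 pos by (intro mult_left_mono) auto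
    moreover have "x$i * x$j > 0" using pos by simp
    ultimately show False
      using gi unfolding g by (simp add: power2_eq_square algebra_simps)
  qed
qed

lemma disjoint_s_curves: "disjoint_family s_curve"
proof -
  have "s_curve m \<inter> s_curve n = {}" if "m \<noteq> n" for m n
  proof -
    have "n = m + 1 \<or> n = m + 2"
      using that exhaust_3[of m] exhaust_3[of n] by auto
    hence "\<exists>l. {n, l, m} = {1, 2, 3}"
      using index_triple[of m] by (metis insert_commute)
    then obtain l where "{n, l, m} = {1, 2, 3}" by blast
    thus ?thesis
      using gamma_poly_pos_if_other_nonpos[of n l m] by (force simp: s_curve_def Gamma_set_def)
  qed
  thus ?thesis by (simp add: disjoint_family_on_def)
qed

text \<open>With \<open>\<gamma>\<^sub>m(x) = 0\<close>, multiplying \<open>\<gamma>\<^sub>m\<close> at \<open>(s x\<^sub>i, s x\<^sub>j, x\<^sub>m / s\<^sup>2)\<close> by \<open>s\<^sup>4\<close> leaves a polynomial in \<open>s\<close>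
  that is positive for all \<open>s > 1\<close>.  The other two forms are positive at \<open>x\<close>, hence also nearby.\<close>

lemma s_curve_subset_closure: "s_curve m \<subseteq> closure unit_volume_pos_curv"
proof
  fix x assume x: "x \<in> s_curve m"
  define i j where "i = m + 1" and "j = m + 2"
  have ijm: "{i, j, m} = {1, 2, 3}" unfolding i_def j_def by (rule index_triple)
  note mij = index_permute(4)[OF ijm] and jim = index_permute(2)[OF ijm]
  note d = index_distinct[OF ijm]
  have xu: "x \<in> unit_volume" and g0: "gamma_poly m x = 0"
    using x by (auto simp: s_curve_def Gamma_set_def)
  hence xm: "x \<in> metrics" by (simp add: unit_volume_def)
  have pos: "x $ i > 0" "x $ j > 0" "x $ m > 0" and vol: "x $ i * x $ j * x $ m = 1"
    using xu unit_volume_iff[OF ijm] by auto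
  define y where "y s = (\<chi> n. if n = m then x $ m / s^2 else s * x $ n)" for s :: real
  have y_comp: "y s $ m = x $ m / s^2" "y s $ i = s * x $ i" "y s $ j = s * x $ j" for s
    using d by (auto simp: y_def)
  have y1: "y 1 = x" by (auto simp: y_def vec_eq_iff)
  have "((\<lambda>s. y s) \<longlongrightarrow> y 1) (at_right 1)"
    unfolding y_def by (intro tendsto_vec_lambda) (auto intro!: tendsto_eq_intros)
  hence lim: "(y \<longlongrightarrow> x) (at_right 1)" unfolding y1 .
  have ev: "eventually (\<lambda>s. gamma_poly n (y s) > 0) (at_right 1)" if "gamma_poly n x > 0" for n
  proof -
    have "isCont (gamma_poly n) x"
      using continuous_on_gamma_poly[of UNIV n] by (simp add: continuous_on_eq_continuous_at)
    hence "((\<lambda>s. gamma_poly n (y s)) \<longlongrightarrow> gamma_poly n x) (at_right 1)"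
      by (rule isCont_tendsto_compose[OF _ lim])
    thus ?thesis using that by (rule order_tendstoD)
  qed
  have "gamma_poly i x > 0" "gamma_poly j x > 0"
    using gamma_poly_pos_if_other_nonpos[OF ijm xm] gamma_poly_pos_if_other_nonpos[OF jim xm] g0
    by auto
  note ev_ij = ev[OF this(1)] ev[OF this(2)]
  have "eventually (\<lambda>s. s > 1) (at_right (1::real))" by (rule eventually_at_right_less)
  with ev_ij have "eventually (\<lambda>s. y s \<in> closure unit_volume_pos_curv) (at_right 1)"
  proof eventually_elim
    case (elim s)
    have "s^2 * s^2 * gamma_poly m (y s)
        = s^6 * (x$i - x$j)^2 + 2 * s^3 * (x$m * (x$i + x$j)) - 3 * (x$m)^2"
      using elim(3) unfolding gamma_poly_eq[OF mij] y_comp by (simp add: field_simps) algebra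
    also have "\<dots> = (s^6 - 1) * (x$i - x$j)^2 + 2 * (s^3 - 1) * (x$m * (x$i + x$j))"
      using g0 unfolding gamma_poly_eq[OF mij] by algebra
    also have "\<dots> > 0"
      using elim(3) pos by (intro add_nonneg_pos mult_nonneg_nonneg mult_pos_pos) auto
    finally have "gamma_poly m (y s) > 0"
      using elim(3) by (simp add: zero_less_mult_iff)
    hence "\<forall>n. gamma_poly n (y s) > 0" using elim index_exhaust[OF ijm] by metis
    moreover have "y s \<in> unit_volume"
      unfolding unit_volume_iff[OF ijm] y_comp
      using elim(3) pos vol by (auto simp: power2_eq_square mult_ac)
    ultimately have "y s \<in> unit_volume_pos_curv"
      by (auto simp: unit_volume_pos_curv_def pos_curv_metrics_def unit_volume_def)
    thus ?case using closure_subset by auto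
  qed
  thus "x \<in> closure unit_volume_pos_curv"
    by (intro Lim_in_closed_set[OF _ _ _ lim]) auto
qed

lemma frontier_unit_volume_pos_curv:
  "(top_of_set unit_volume) frontier_of unit_volume_pos_curv = (\<Union>m. s_curve m)"
proof -
  have alt: "unit_volume_pos_curv = unit_volume \<inter> (\<Inter>m. {x. 0 < gamma_poly m x})"
    by (auto simp: unit_volume_pos_curv_def pos_curv_metrics_def unit_volume_def)
  have "open (\<Inter>m. {x. 0 < gamma_poly m x})"
    by (intro open_INT ballI open_Collect_less continuous_on_const continuous_on_gamma_poly) auto
  hence "openin (top_of_set unit_volume) unit_volume_pos_curv"
    unfolding alt by (rule openin_open_Int)
  hence fr: "(top_of_set unit_volume) frontier_of unit_volume_pos_curv
      = unit_volume \<inter> closure unit_volume_pos_curv - unit_volume_pos_curv"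
    by (simp add: frontier_of_def interior_of_openin closure_of_subtopology alt)
  have "closed (\<Inter>m. {x. 0 \<le> gamma_poly m x})"
    by (intro closed_INT ballI closed_Collect_le continuous_on_const continuous_on_gamma_poly)
  hence nonneg_closure: "closure unit_volume_pos_curv \<subseteq> (\<Inter>m. {x. 0 \<le> gamma_poly m x})"
    by (rule closure_minimal[rotated]) (auto simp: alt intro: less_imp_le)
  have "unit_volume \<inter> closure unit_volume_pos_curv - unit_volume_pos_curv \<subseteq> (\<Union>m. s_curve m)"
    (is "?L \<subseteq> _")
  proof (intro subsetI)
    fix x assume x: "x \<in> ?L"
    hence nonneg: "\<And>m. 0 \<le> gamma_poly m x" using nonneg_closure by auto
    obtain m where "\<not> 0 < gamma_poly m x" using x alt by auto
    with nonneg[of m] have "gamma_poly m x = 0" by simp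
    thus "x \<in> (\<Union>m. s_curve m)" using x by (auto simp: s_curve_def Gamma_set_def unit_volume_def)
  qed
  moreover have "(\<Union>m. s_curve m) \<subseteq> unit_volume - unit_volume_pos_curv"
  proof (intro subsetI)
    fix x assume "x \<in> (\<Union>m. s_curve m)"
    then obtain m where "x \<in> unit_volume" "gamma_poly m x = 0"
      by (auto simp: s_curve_def Gamma_set_def)
    moreover from this have "x \<notin> (\<Inter>m. {x. 0 < gamma_poly m x})" by (metis INT_D UNIV_I less_irrefl mem_Collect_eq)
    ultimately show "x \<in> unit_volume - unit_volume_pos_curv" by (simp add: alt)
  qed
  ultimately show ?thesis unfolding fr using s_curve_subset_closure by blast
qed

section \<open>The parametrization of the boundary curves\<close>

definition disc_root :: "real \<Rightarrow> real" where
  "disc_root t = sqrt (t^2 - t + 1)"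

text \<open>The value of \<open>x\<^sub>k / x\<^sub>j\<close> on \<open>s\<^sub>k\<close> when \<open>x\<^sub>i / x\<^sub>j = t\<close>, that is, the positive root \<open>z\<close> of
  \<open>(t - 1)\<^sup>2 + 2 z (t + 1) - 3 z\<^sup>2\<close>.\<close>

definition top_ratio :: "real \<Rightarrow> real" where
  "top_ratio t = (t + 1 + 2 * disc_root t) / 3"

lemma disc_pos: "t^2 - t + 1 > (0::real)"
proof -
  have "t^2 - t + 1 = (t - 1/2)^2 + 3/4" by (simp add: power2_eq_square algebra_simps)
  thus ?thesis using zero_le_power2[of "t - 1/2"] by linarith
qed

lemma disc_root_pos: "disc_root t > 0"
  using disc_pos by (simp add: disc_root_def)

lemma disc_root_sq: "(disc_root t)^2 = t^2 - t + 1"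
  using disc_pos[of t] by (simp add: disc_root_def)

lemma top_ratio_pos: "t > 0 \<Longrightarrow> top_ratio t > 0"
  using disc_root_pos[of t] by (simp add: top_ratio_def)

lemma disc_root_ge: "t > 0 \<Longrightarrow> 2 * disc_root t \<ge> t + 1"
proof (rule power2_le_imp_le)
  have "(2 * disc_root t)^2 - (t + 1)^2 = 3 * (t - 1)^2"
    using disc_root_sq[of t] by algebra
  thus "(t + 1)^2 \<le> (2 * disc_root t)^2" using zero_le_power2[of "t - 1"] by linarith
qed (use disc_root_pos[of t] in auto)

text \<open>Rationalizing the numerator cancels the factor \<open>(t - 1)\<^sup>2\<close>, because
  \<open>4 (t\<^sup>2 - t + 1) - (t + 1)\<^sup>2 = 3 (t - 1)\<^sup>2\<close>.  The resulting formula is uniform in \<open>t > 0\<close> and shows that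
  the value prescribed at \<open>t = 1\<close> is the continuous one.\<close>

lemma alpha_eq:
  assumes "t > 0"
  shows "alpha t = root 3 (1 / (t * top_ratio t))"
proof (cases "t = 1")
  case True
  have "root 3 6 / 2 = root 3 (3/4)"
    by (rule real_root_pos_unique[symmetric]) (auto simp: power_divide)
  thus ?thesis using True by (simp add: alpha_def top_ratio_def disc_root_def)
next
  case False
  have "(2 * disc_root t - t - 1) * (t * top_ratio t) = t * (t - 1)^2"
    using disc_root_sq[of t] unfolding top_ratio_def by (simp add: field_simps) algebra
  hence "(- t - 1 + 2 * disc_root t) / (t * (t - 1)^2) = 1 / (t * top_ratio t)"
    using False assms top_ratio_pos[OF assms] by (simp add: field_simps)
  thus ?thesis using False by (simp add: alpha_def disc_root_def)
qed

lemma alpha_pos: "t > 0 \<Longrightarrow> alpha t > 0"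
  using top_ratio_pos[of t] by (simp add: alpha_eq)

lemma alpha_cube: "t > 0 \<Longrightarrow> t * top_ratio t * (alpha t)^3 = 1"
  using top_ratio_pos[of t] by (simp add: alpha_eq)

text \<open>As a quadratic in \<open>x\<^sub>k\<close> the form has one positive root and one root that is \<open>\<le> 0\<close>; the factor
  of the latter does not vanish on positive triples.\<close>

lemma gamma_poly_eq_0_iff:
  assumes ijk: "{i, j, k} = {1, 2, 3}" and x: "x \<in> metrics"
  shows "gamma_poly k x = 0 \<longleftrightarrow> x $ k = x $ j * top_ratio (x $ i / x $ j)"
proof -
  note kij = index_permute(4)[OF ijk]
  have pos: "x $ i > 0" "x $ j > 0" "x $ k > 0" using x by (auto simp: metrics_def)
  define t where "t = x $ i / x $ j"
  have t: "t > 0" and xi: "x $ i = t * x $ j" using pos by (auto simp: t_def)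
  have "3 * gamma_poly k x
      = (x$j * (2 * disc_root t + t + 1) - 3 * x$k) * (x$j * (2 * disc_root t - t - 1) + 3 * x$k)"
  proof -
    have "4 * (disc_root t)^2 = 4 * (t^2 - t + 1)" by (simp add: disc_root_sq)
    hence "(x$j)^2 * (4 * (disc_root t)^2) = (x$j)^2 * (4 * (t^2 - t + 1))" by simp
    thus ?thesis unfolding gamma_poly_eq[OF kij] xi by (simp add: power2_eq_square algebra_simps)
  qed
  moreover have "x$j * (2 * disc_root t - t - 1) + 3 * x$k > 0"
    using pos disc_root_ge[OF t] by (intro add_nonneg_pos mult_nonneg_nonneg) auto
  ultimately have "gamma_poly k x = 0 \<longleftrightarrow> x$j * (2 * disc_root t + t + 1) - 3 * x$k = 0"
    by (smt (verit) mult_eq_0_iff)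
  thus ?thesis unfolding t_def[symmetric] top_ratio_def by (auto simp: field_simps)
qed

lemma s_param_component:
  assumes ijk: "{i, j, k} = {1, 2, 3}" and t: "t > 0"
  shows "s_param i j t $ i = t * alpha t" "s_param i j t $ j = alpha t"
    "s_param i j t $ k = alpha t * top_ratio t"
proof -
  have "1 / (t * (alpha t)^2) = alpha t * top_ratio t"
    using alpha_cube[OF t] alpha_pos[OF t] t
    by (simp add: field_simps power3_eq_cube power2_eq_square)
  thus "s_param i j t $ i = t * alpha t" "s_param i j t $ j = alpha t"
    "s_param i j t $ k = alpha t * top_ratio t"
    using index_distinct[OF ijk] by (auto simp: s_param_def)
qed

lemma s_param_in_s_curve:
  assumes ijk: "{i, j, k} = {1, 2, 3}" and t: "t > 0"
  shows "s_param i j t \<in> s_curve k"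
proof -
  note c = s_param_component[OF ijk t]
  have "s_param i j t \<in> unit_volume"
    unfolding unit_volume_iff[OF ijk] c using t alpha_pos[OF t] top_ratio_pos[OF t] alpha_cube[OF t]
    by (simp add: power3_eq_cube mult_ac)
  moreover from this have m: "s_param i j t \<in> metrics" by (simp add: unit_volume_def)
  moreover have "gamma_poly k (s_param i j t) = 0"
    unfolding gamma_poly_eq_0_iff[OF ijk m] c using alpha_pos[OF t] by simp
  ultimately show ?thesis by (simp add: s_curve_def Gamma_set_def)
qed

lemma s_curve_eq_s_param:
  assumes ijk: "{i, j, k} = {1, 2, 3}" and x: "x \<in> s_curve k"
  shows "x = s_param i j (x $ i / x $ j)"
proof -
  define t where "t = x $ i / x $ j"
  have xu: "x \<in> unit_volume" and xm: "x \<in> metrics" and g0: "gamma_poly k x = 0"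
    using x by (auto simp: s_curve_def Gamma_set_def)
  have pos: "x $ i > 0" "x $ j > 0" "x $ k > 0" and vol: "x $ i * x $ j * x $ k = 1"
    using xu unit_volume_iff[OF ijk] by auto
  have t: "t > 0" and xi: "x $ i = t * x $ j" using pos by (auto simp: t_def)
  have xk: "x $ k = x $ j * top_ratio t"
    using gamma_poly_eq_0_iff[OF ijk xm] g0 by (simp add: t_def)
  have "t * top_ratio t * (x $ j)^3 = 1"
    using vol unfolding xi xk by (simp add: power3_eq_cube mult_ac)
  hence "(x $ j)^3 = (alpha t)^3"
    using alpha_cube[OF t] t top_ratio_pos[OF t]
    by (metis mult_left_cancel mult_pos_pos less_irrefl)
  hence xj: "x $ j = alpha t"
    using pos alpha_pos[OF t] by (simp add: power_eq_iff_eq_base)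
  have "x $ n = s_param i j t $ n" for n
    using index_exhaust[OF ijk, of n] s_param_component[OF ijk t] xi xj xk by auto
  thus ?thesis unfolding t_def[symmetric] vec_eq_iff by blast
qed

section \<open>Smoothness and regularity\<close>

lemma has_vector_derivative_vec_lambda:
  fixes f :: "'n::finite \<Rightarrow> real \<Rightarrow> real"
  assumes "\<And>m. (f m has_real_derivative f' m) (at t within T)"
  shows "((\<lambda>t. \<chi> m. f m t) has_vector_derivative (\<chi> m. f' m)) (at t within T)"
proof -
  have "((\<lambda>t. \<Sum>m\<in>UNIV. f m t *\<^sub>R axis m 1) has_vector_derivative
      (\<Sum>m\<in>UNIV. f' m *\<^sub>R axis m (1::real))) (at t within T)"
    using assms by (intro has_vector_derivative_sum)
      (auto intro!: derivative_eq_intros simp: has_real_derivative_iff_has_vector_derivative)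
  moreover have "(\<Sum>m\<in>UNIV. g m *\<^sub>R axis m (1::real)) = (\<chi> m. g m)" for g :: "'n \<Rightarrow> real"
    by (simp add: vec_eq_iff axis_def if_distrib sum.If_cases cong: if_cong)
  ultimately show ?thesis by simp
qed

lemma smooth_curve_on_vec_lambda:
  fixes f :: "'n::finite \<Rightarrow> real \<Rightarrow> real"
  assumes "\<And>m. smooth_curve_on (f m) T"
  shows "smooth_curve_on (\<lambda>t. \<chi> m. f m t) T"
proof -
  obtain D where D0: "\<And>m. D m 0 = f m"
    and D: "\<And>m n t. t \<in> T \<Longrightarrow> (D m n has_real_derivative D m (Suc n) t) (at t within T)"
    using assms unfolding smooth_curve_on_def has_real_derivative_iff_has_vector_derivative
    by metis
  show ?thesis
    unfolding smooth_curve_on_def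
    by (rule exI[of _ "\<lambda>n t. \<chi> m. D m n t"])
      (auto simp: D0 intro!: has_vector_derivative_vec_lambda D)
qed

text \<open>If each generator of an algebra of functions has its derivative in the algebra, then
  differentiation maps the algebra to itself, so every member can be differentiated indefinitely.
  This replaces explicit formulas for the higher derivatives.\<close>

inductive_set generated_algebra :: "(real \<Rightarrow> real) set \<Rightarrow> (real \<Rightarrow> real) set"
  for F :: "(real \<Rightarrow> real) set" where
  gen: "f \<in> F \<Longrightarrow> f \<in> generated_algebra F"
| const: "(\<lambda>t. c) \<in> generated_algebra F"
| add: "\<lbrakk>f \<in> generated_algebra F; g \<in> generated_algebra F\<rbrakk> \<Longrightarrow> (\<lambda>t. f t + g t) \<in> generated_algebra F"
| mult: "\<lbrakk>f \<in> generated_algebra F; g \<in> generated_algebra F\<rbrakk> \<Longrightarrow> (\<lambda>t. f t * g t) \<in> generated_algebra F"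

lemma smooth_curve_on_generated_algebra:
  assumes gens: "\<And>f. f \<in> F \<Longrightarrow>
      \<exists>f' \<in> generated_algebra F. \<forall>t\<in>T. (f has_real_derivative f' t) (at t within T)"
    and f: "f \<in> generated_algebra F"
  shows "smooth_curve_on f T"
proof -
  have "\<exists>f' \<in> generated_algebra F. \<forall>t\<in>T. (f has_real_derivative f' t) (at t within T)"
    if "f \<in> generated_algebra F" for f
    using that
  proof induction
    case (gen f)
    thus ?case by (rule gens)
  next
    case (const c)
    show ?case
      by (rule bexI[of _ "\<lambda>t. 0"]) (auto intro: generated_algebra.const)
  next
    case (add f g)
    then obtain f' g' where "f' \<in> generated_algebra F" "g' \<in> generated_algebra F"
      "\<forall>t\<in>T. (f has_real_derivative f' t) (at t within T)"
      "\<forall>t\<in>T. (g has_real_derivative g' t) (at t within T)" by blast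
    thus ?case
      by (intro bexI[of _ "\<lambda>t. f' t + g' t"])
        (auto intro: generated_algebra.add DERIV_add)
  next
    case (mult f g)
    then obtain f' g' where "f' \<in> generated_algebra F" "g' \<in> generated_algebra F"
      "\<forall>t\<in>T. (f has_real_derivative f' t) (at t within T)"
      "\<forall>t\<in>T. (g has_real_derivative g' t) (at t within T)" by blast
    with mult.hyps show ?case
      by (intro bexI[of _ "\<lambda>t. f' t * g t + g' t * f t"])
        (auto intro!: generated_algebra.add generated_algebra.mult DERIV_mult)
  qed
  then obtain d where d: "\<And>f. f \<in> generated_algebra F \<Longrightarrow> d f \<in> generated_algebra F"
    "\<And>f t. f \<in> generated_algebra F \<Longrightarrow> t \<in> T \<Longrightarrow> (f has_real_derivative d f t) (at t within T)"
    by metis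
  have "(d ^^ n) f \<in> generated_algebra F" for n
    by (induction n) (auto intro: d f)
  thus ?thesis
    unfolding smooth_curve_on_def has_real_derivative_iff_has_vector_derivative[symmetric]
    by (intro exI[of _ "\<lambda>n. (d ^^ n) f"]) (auto intro: d)
qed

lemma disc_root_deriv: "(disc_root has_real_derivative (2 * t - 1) / (2 * disc_root t)) (at t)"
  unfolding disc_root_def
  by (rule derivative_eq_intros refl | use disc_pos[of t] in \<open>simp add: field_simps\<close>)+

lemma top_ratio_deriv:
  "(top_ratio has_real_derivative (1 + (2 * t - 1) / disc_root t) / 3) (at t)"
  unfolding top_ratio_def using disc_root_pos[of t]
  by (auto intro!: derivative_eq_intros disc_root_deriv simp: field_simps)

text \<open>Logarithmic differentiation of \<open>\<alpha>\<^sup>3 = 1 / (t \<cdot> top_ratio t)\<close>.\<close>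

lemma alpha_deriv:
  assumes t: "t > 0"
  shows "(alpha has_real_derivative
      - (1/3) * alpha t * (1 / t + (1 + (2 * t - 1) / disc_root t) / 3 / top_ratio t)) (at t)"
proof (rule has_field_derivative_transform_within_open)
  define g where "g s = exp (- (1/3) * (ln s + ln (top_ratio s)))" for s
  have g_alpha: "g s = alpha s" if s: "s \<in> {0<..}" for s
  proof -
    have "(g s)^3 = exp (- ln s - ln (top_ratio s))"
      by (simp add: g_def exp_of_nat_mult[symmetric] add_divide_distrib)
    also have "\<dots> = 1 / (s * top_ratio s)"
      using s top_ratio_pos[of s] by (simp add: exp_diff exp_minus field_simps)
    finally have "root 3 (1 / (s * top_ratio s)) = g s"
      by (intro real_root_pos_unique) (auto simp: g_def)
    thus ?thesis using s by (simp add: alpha_eq)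
  qed
  thus "\<And>s. s \<in> {0<..} \<Longrightarrow> g s = alpha s" .
  show "(g has_real_derivative
      - (1/3) * alpha t * (1 / t + (1 + (2 * t - 1) / disc_root t) / 3 / top_ratio t)) (at t)"
    unfolding g_alpha[symmetric, of t, simplified, OF t]
    unfolding g_def using t top_ratio_pos[OF t]
    by (auto intro!: derivative_eq_intros top_ratio_deriv simp: field_simps)
qed (use t in auto)

lemma isCont_alpha: "t > 0 \<Longrightarrow> isCont alpha t"
  using alpha_deriv DERIV_isCont by blast

text \<open>The reciprocals make the algebra closed under differentiation; \<open>1 / \<alpha>\<close> also occurs in the
  third coordinate \<open>1 / (t \<alpha>\<^sup>2)\<close> of the curve.  The function \<open>top_ratio\<close> is itself a polynomial
  in the generators.\<close>

definition curve_generators :: "(real \<Rightarrow> real) set" where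
  "curve_generators = {\<lambda>t. t, \<lambda>t. 1 / t, disc_root, \<lambda>t. 1 / disc_root t,
     \<lambda>t. 1 / top_ratio t, alpha, \<lambda>t. 1 / alpha t}"

lemma smooth_curve_on_curve_generators:
  assumes f: "f \<in> generated_algebra curve_generators"
  shows "smooth_curve_on f {0<..}"
proof (rule smooth_curve_on_generated_algebra[OF _ f])
  note alg = generated_algebra.intros[of _ curve_generators]
  let ?A = "generated_algebra curve_generators"
  have gens: "(\<lambda>t. t) \<in> ?A" "(\<lambda>t. 1 / t) \<in> ?A" "disc_root \<in> ?A" "(\<lambda>t. 1 / disc_root t) \<in> ?A"
    "(\<lambda>t. 1 / top_ratio t) \<in> ?A" "alpha \<in> ?A" "(\<lambda>t. 1 / alpha t) \<in> ?A"
    by (auto intro!: generated_algebra.gen simp: curve_generators_def)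
  \<comment> \<open>the derivative of \<open>top_ratio\<close>, written with generators only\<close>
  define r where "r t = (1 + (2 * t + (- 1)) * (1 / disc_root t)) * (1/3)" for t
  have rA: "r \<in> ?A" unfolding r_def by (intro alg gens)
  have top_ratio_r: "(top_ratio has_real_derivative r t) (at t within T)" for t T
    using DERIV_subset[OF top_ratio_deriv[of t]] by (simp add: r_def)
  fix f assume "f \<in> curve_generators"
  then consider "f = (\<lambda>t. t)" | "f = (\<lambda>t. 1 / t)" | "f = disc_root"
    | "f = (\<lambda>t. 1 / disc_root t)" | "f = (\<lambda>t. 1 / top_ratio t)" | "f = alpha"
    | "f = (\<lambda>t. 1 / alpha t)"
    by (auto simp: curve_generators_def)
  thus "\<exists>f'\<in>?A. \<forall>t\<in>{0<..}. (f has_real_derivative f' t) (at t within {0<..})"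
  proof cases
    case 1
    show ?thesis unfolding 1
      by (rule bexI[of _ "\<lambda>t. 1"]) (auto intro!: derivative_eq_intros alg gens)
  next
    case 2
    show ?thesis unfolding 2
      by (rule bexI[of _ "\<lambda>t. (- 1) * (1 / t) * (1 / t)"], force intro!: derivative_eq_intros)
        (intro alg gens)
  next
    case 3
    show ?thesis unfolding 3
      by (rule bexI[of _ "\<lambda>t. (1/2) * (2 * t + (- 1)) * (1 / disc_root t)"],
          force intro!: derivative_eq_intros DERIV_subset[OF disc_root_deriv])
        (intro alg gens)
  next
    case 4
    show ?thesis unfolding 4
    proof (intro bexI[of _ "\<lambda>t. (- 1) * ((1/2) * (2 * t + (- 1)) * (1 / disc_root t)) *
        (1 / disc_root t) * (1 / disc_root t)"] ballI)
      fix t :: real assume "t \<in> {0<..}"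
      show "((\<lambda>t. 1 / disc_root t) has_real_derivative
          (- 1) * ((1/2) * (2 * t + (- 1)) * (1 / disc_root t)) *
            (1 / disc_root t) * (1 / disc_root t)) (at t within {0<..})"
        using disc_root_pos[of t]
        by (auto intro!: derivative_eq_intros DERIV_subset[OF disc_root_deriv] simp: field_simps)
    qed (intro alg gens)
  next
    case 5
    show ?thesis unfolding 5
    proof (intro bexI[of _ "\<lambda>t. (- 1) * r t * (1 / top_ratio t) * (1 / top_ratio t)"] ballI)
      fix t :: real assume "t \<in> {0<..}"
      thus "((\<lambda>t. 1 / top_ratio t) has_real_derivative
          (- 1) * r t * (1 / top_ratio t) * (1 / top_ratio t)) (at t within {0<..})"
        using top_ratio_pos[of t]
        by (auto intro!: derivative_eq_intros top_ratio_r)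
    qed (intro alg gens rA)
  next
    case 6
    show ?thesis unfolding 6
    proof (intro bexI[of _ "\<lambda>t. (- 1/3) * alpha t * (1 / t + r t * (1 / top_ratio t))"] ballI)
      fix t :: real assume "t \<in> {0<..}"
      thus "(alpha has_real_derivative
          (- 1/3) * alpha t * (1 / t + r t * (1 / top_ratio t))) (at t within {0<..})"
        using DERIV_subset[OF alpha_deriv[of t]] by (simp add: r_def)
    qed (intro alg gens rA)
  next
    case 7
    show ?thesis unfolding 7
    proof (intro bexI[of _ "\<lambda>t. (1/3) * (1 / alpha t) * (1 / t + r t * (1 / top_ratio t))"] ballI)
      fix t :: real assume "t \<in> {0<..}"
      thus "((\<lambda>t. 1 / alpha t) has_real_derivative
          (1/3) * (1 / alpha t) * (1 / t + r t * (1 / top_ratio t))) (at t within {0<..})"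
        using alpha_pos[of t]
        by (auto intro!: derivative_eq_intros DERIV_subset[OF alpha_deriv] simp: r_def)
    qed (intro alg gens rA)
  qed
qed

lemma smooth_s_param: "smooth_curve_on (s_param i j) {0<..}"
proof -
  let ?A = "generated_algebra curve_generators"
  have gens: "(\<lambda>t. t) \<in> ?A" "(\<lambda>t. 1 / t) \<in> ?A" "(\<lambda>t. 1 / alpha t) \<in> ?A" "alpha \<in> ?A"
    by (auto intro!: generated_algebra.gen simp: curve_generators_def)
  have "(\<lambda>t. t * alpha t) \<in> ?A" "(\<lambda>t. (1 / t) * ((1 / alpha t) * (1 / alpha t))) \<in> ?A"
    by (intro generated_algebra.mult gens)+
  hence "(\<lambda>t. if m = i then t * alpha t else if m = j then alpha t
      else 1 / (t * (alpha t)^2)) \<in> ?A" for m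
    using gens by (cases "m = i"; cases "m = j") (simp_all add: power2_eq_square)
  thus ?thesis
    unfolding s_param_def
    by (intro smooth_curve_on_vec_lambda smooth_curve_on_curve_generators)
qed

text \<open>The quotient of the coordinates \<open>i\<close> and \<open>j\<close> is \<open>t\<close> itself, so these two coordinates cannot both
  be stationary.\<close>

lemma s_param_immersion:
  assumes "i \<noteq> j" and t: "t > 0"
  shows "vector_derivative (s_param i j) (at t) \<noteq> 0"
proof
  assume v: "vector_derivative (s_param i j) (at t) = 0"
  obtain v' where "(s_param i j has_vector_derivative v') (at t within {0<..})"
    using smooth_s_param[of i j] t unfolding smooth_curve_on_def by (metis greaterThan_iff)
  hence "(s_param i j has_vector_derivative v') (at t)"
    using t by (simp add: at_within_open[of t "{0<..}"])
  with v have "(s_param i j has_vector_derivative 0) (at t)"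
    by (simp add: vector_derivative_at)
  hence "((\<lambda>s. s_param i j s $ m) has_real_derivative 0) (at t)" for m
    using bounded_linear.has_vector_derivative[OF bounded_linear_vec_nth]
    by (fastforce simp: has_real_derivative_iff_has_vector_derivative)
  from this[of i] this[of j]
  have di: "((\<lambda>s. s * alpha s) has_real_derivative 0) (at t)"
    and dj: "(alpha has_real_derivative 0) (at t)"
    using \<open>i \<noteq> j\<close> by (simp_all add: s_param_def)
  have "((\<lambda>s. s * alpha s) has_real_derivative 1 * alpha t + 0 * t) (at t)"
    by (intro DERIV_mult DERIV_ident dj)
  with di have "0 = 1 * alpha t + 0 * t" by (rule DERIV_unique)
  thus False using alpha_pos[OF t] by simp
qed

lemma regular_parametrization_s_param:
  assumes ijk: "{i, j, k} = {1, 2, 3}"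
  shows "regular_parametrization (s_param i j) {0<..} (s_curve k)"
proof -
  have pos: "x $ i > 0" "x $ j > 0" if "x \<in> s_curve k" for x
    using that by (auto simp: s_curve_def Gamma_set_def metrics_def)
  have cont: "continuous_on {0<..} (s_param i j)"
    using smooth_s_param[of i j] unfolding smooth_curve_on_def
    by (metis has_vector_derivative_continuous continuous_on_eq_continuous_within)
  have "homeomorphism {0<..} (s_curve k) (s_param i j) (\<lambda>x. x $ i / x $ j)"
  proof
    show "continuous_on (s_curve k) (\<lambda>x. x $ i / x $ j)"
      using pos by (intro continuous_intros) force
    show "s_param i j ` {0<..} \<subseteq> s_curve k" using s_param_in_s_curve[OF ijk] by auto
    show "(\<lambda>x. x $ i / x $ j) ` s_curve k \<subseteq> {0<..}" using pos by auto
    show "s_param i j t $ i / s_param i j t $ j = t" if "t \<in> {0<..}" for t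
      using that alpha_pos[of t] by (simp add: s_param_component[OF ijk])
    show "s_param i j (x $ i / x $ j) = x" if "x \<in> s_curve k" for x
      using s_curve_eq_s_param[OF ijk that] by simp
  qed (rule cont)
  thus ?thesis
    using smooth_s_param s_param_immersion index_distinct[OF ijk]
    by (auto simp: regular_parametrization_def is_interval_def)
qed

lemma connected_s_curve:
  assumes ijk: "{i, j, k} = {1, 2, 3}"
  shows "connected (s_curve k)"
proof -
  obtain g where "homeomorphism {0<..} (s_curve k) (s_param i j) g"
    using regular_parametrization_s_param[OF ijk] by (auto simp: regular_parametrization_def)
  hence "s_curve k = s_param i j ` {0<..}" "continuous_on {0<..} (s_param i j)"
    by (auto simp: homeomorphism_def)
  thus ?thesis by (auto intro: connected_continuous_image)
qed

lemma regular_curve_s_curve: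
  assumes ijk: "{i, j, k} = {1, 2, 3}"
  shows "regular_curve (s_curve k)"
  unfolding regular_curve_def
  using regular_parametrization_s_param[OF ijk]
  by (intro ballI exI[of _ UNIV] exI[of _ "{0<..}"] exI[of _ "s_param i j"]) auto

section \<open>The invariant curves\<close>

lemma I_curve_iff:
  assumes ijk: "{i, j, k} = {1, 2, 3}"
  shows "x \<in> I_curve k \<longleftrightarrow> x \<in> unit_volume \<and> x $ i = x $ j"
proof (intro iffI conjI)
  note d = index_distinct[OF ijk]
  assume "x \<in> I_curve k"
  thus "x \<in> unit_volume" "x $ i = x $ j" using d by (auto simp: I_curve_def I_point_def)
next
  note d = index_distinct[OF ijk]
  assume x: "x \<in> unit_volume \<and> x $ i = x $ j"
  hence pos: "x $ j > 0" and "x $ j * x $ j * x $ k = 1"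
    using unit_volume_iff[OF ijk] by auto
  hence "x $ k = 1 / (x $ j)^2" by (simp add: field_simps power2_eq_square)
  hence "x $ m = I_point k (x $ j) $ m" for m
    using index_exhaust[OF ijk, of m] x d by (auto simp: I_point_def)
  hence "x = I_point k (x $ j)" unfolding vec_eq_iff by blast
  thus "x \<in> I_curve k" using x pos by (auto simp: I_curve_def)
qed

text \<open>Multiplying by the integrating factor \<open>exp (- \<integral> h)\<close> gives a function with derivative zero.  The
  interval between \<open>s\<close> and \<open>t\<close> serves both directions of time.\<close>

lemma linear_ode_zero:
  fixes u h :: "real \<Rightarrow> real"
  assumes T: "is_interval T" "s \<in> T" "t \<in> T" and us: "u s = 0"
    and u: "\<And>r. r \<in> T \<Longrightarrow> (u has_real_derivative h r * u r) (at r within T)"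
    and h: "continuous_on T h"
  shows "u t = 0"
proof -
  define a b where "a = min s t" and "b = max s t"
  have ab: "{a..b} \<subseteq> T" "s \<in> {a..b}" "t \<in> {a..b}"
    using T connected_contains_Icc[OF is_interval_connected[OF T(1)], of a b]
    by (auto simp: a_def b_def min_def max_def)
  define H where "H r = integral {a..r} h" for r
  have H: "(H has_real_derivative h r) (at r within {a..b})" if "r \<in> {a..b}" for r
    unfolding H_def using that continuous_on_subset[OF h ab(1)]
    by (intro integral_has_real_derivative)
  have "((\<lambda>r. u r * exp (- H r)) has_real_derivative 0) (at r within {a..b})"
    if r: "r \<in> {a..b}" for r
    using ab(1) r by (auto intro!: derivative_eq_intros H DERIV_subset[OF u])
  hence "\<exists>c. \<forall>r\<in>{a..b}. u r * exp (- H r) = c"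
    by (rule has_field_derivative_zero_constant[OF convex_real_interval(5)])
  then obtain c where "\<And>r. r \<in> {a..b} \<Longrightarrow> u r * exp (- H r) = c" by blast
  from this[OF ab(2)] this[OF ab(3)] show ?thesis using us by simp
qed

lemma ricci_solution_component:
  assumes "ricci_solution a x T" "t \<in> T"
  shows "((\<lambda>t. x t $ m) has_real_derivative ricci_field a (x t) $ m) (at t within T)"
  using assms bounded_linear.has_vector_derivative[OF bounded_linear_vec_nth]
  by (fastforce simp: ricci_solution_def has_real_derivative_iff_has_vector_derivative)

text \<open>The left-hand side is the derivative of \<open>x\<^sub>i x\<^sub>j x\<^sub>k\<close> along the flow.  After division by the
  volume, the terms \<open>1 / x\<^sub>j + 1 / x\<^sub>k\<close> sum to \<open>2 (1 / x\<^sub>1 + 1 / x\<^sub>2 + 1 / x\<^sub>3)\<close> and cancel against the constants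
  \<open>-2\<close>, and the coefficients of \<open>a\<close> sum to zero.\<close>

lemma ricci_volume_conserved:
  fixes a :: real
  assumes ijk: "{i, j, k} = {1, 2, 3}" and x: "x \<in> metrics"
  defines "f \<equiv> ricci_field a x"
  shows "f $ i * (x $ j * x $ k) + f $ j * (x $ i * x $ k) + f $ k * (x $ i * x $ j) = 0"
proof -
  have pos: "x $ i > 0" "x $ j > 0" "x $ k > 0" using x by (auto simp: metrics_def)
  show ?thesis
    unfolding f_def ricci_field_eq[OF ijk] ricci_field_eq[OF index_permute(3)[OF ijk]]
      ricci_field_eq[OF index_permute(4)[OF ijk]]
    using pos by (simp add: field_simps power2_eq_square)
qed

text \<open>The cofactor of \<open>x\<^sub>i - x\<^sub>j\<close> in \<open>f\<^sub>i - f\<^sub>j\<close>, where \<open>f\<close> is the Ricci field.\<close>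

definition difference_rate :: "3 \<Rightarrow> 3 \<Rightarrow> 3 \<Rightarrow> real \<Rightarrow> real^3 \<Rightarrow> real" where
  "difference_rate i j k a x = (x$i + x$j) / (x$i * x$j) + 1 / x$k
     + 2 * a * ((x$k)^2 - 2 * (x$i)^2 - 2 * (x$j)^2 - 3 * x$i * x$j) / (x$i * x$j * x$k)"

lemma ricci_field_difference:
  assumes ijk: "{i, j, k} = {1, 2, 3}" and x: "x \<in> metrics"
  shows "ricci_field a x $ i - ricci_field a x $ j
    = difference_rate i j k a x * (x $ i - x $ j)"
proof -
  have pos: "x $ i > 0" "x $ j > 0" "x $ k > 0" using x by (auto simp: metrics_def)
  show ?thesis
    unfolding ricci_field_eq[OF ijk] ricci_field_eq[OF index_permute(3)[OF ijk]]
      difference_rate_def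
    using pos by (simp add: field_simps power2_eq_square)
qed

lemma ricci_invariant_I_curve:
  assumes ijk: "{i, j, k} = {1, 2, 3}"
  shows "ricci_invariant a (I_curve k)"
  unfolding ricci_invariant_def
proof (intro allI impI ballI)
  fix x T t
  assume sol: "ricci_solution a x T" and ex: "\<exists>s\<in>T. x s \<in> I_curve k" and t: "t \<in> T"
  then obtain s where s: "s \<in> T" "x s \<in> I_curve k" by blast
  have T: "is_interval T" and m: "\<And>r. r \<in> T \<Longrightarrow> x r \<in> metrics"
    using sol by (auto simp: ricci_solution_def)
  note der = ricci_solution_component[OF sol]
  have pos: "x r $ m > 0" if "r \<in> T" for r m using m[OF that] by (simp add: metrics_def)
  have "((\<lambda>r. x r $ i * x r $ j * x r $ k) has_real_derivative 0) (at r within T)"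
    if r: "r \<in> T" for r
    using ricci_volume_conserved[OF ijk m[OF r], of a]
    by (auto intro!: derivative_eq_intros der[OF r] simp: algebra_simps)
  hence "\<exists>c. \<forall>r\<in>T. x r $ i * x r $ j * x r $ k = c"
    by (rule has_field_derivative_zero_constant[OF is_interval_convex[OF T]])
  then obtain c where "\<And>r. r \<in> T \<Longrightarrow> x r $ i * x r $ j * x r $ k = c" by blast
  from this[OF t] this[OF s(1)] have "x t $ i * x t $ j * x t $ k = 1"
    using s(2) unfolding I_curve_iff[OF ijk] unit_volume_iff[OF ijk] by linarith
  hence "x t \<in> unit_volume" using pos[OF t] by (simp add: unit_volume_iff[OF ijk])
  moreover have "x t $ i - x t $ j = 0"
  proof (rule linear_ode_zero[where u = "\<lambda>r. x r $ i - x r $ j" and T = T and s = s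
        and h = "\<lambda>r. difference_rate i j k a (x r)"])
    show "x s $ i - x s $ j = 0" using s I_curve_iff[OF ijk] by simp
    show "((\<lambda>r. x r $ i - x r $ j) has_real_derivative
        difference_rate i j k a (x r) * (x r $ i - x r $ j)) (at r within T)" if r: "r \<in> T" for r
      unfolding ricci_field_difference[OF ijk m[OF r], symmetric]
      by (intro DERIV_diff der r)
    have "continuous_on T x"
      using sol unfolding ricci_solution_def continuous_on_eq_continuous_within
      by (blast intro: has_vector_derivative_continuous)
    moreover have "x r $ n \<noteq> 0" if "r \<in> T" for r n using pos[OF that, of n] by simp
    ultimately show "continuous_on T (\<lambda>r. difference_rate i j k a (x r))"
      unfolding difference_rate_def by (intro continuous_intros) simp_all
  qed (use T s t in auto)
  ultimately show "x t \<in> I_curve k" by (simp add: I_curve_iff[OF ijk])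
qed

section \<open>Position of the invariant curves relative to the boundary curves\<close>

lemma I_point_component:
  assumes ijk: "{i, j, k} = {1, 2, 3}"
  shows "I_point k p $ i = p" "I_point k p $ j = p" "I_point k p $ k = 1 / p^2"
  using index_distinct[OF ijk] by (auto simp: I_point_def)

lemma I_point_in_I_curve:
  assumes ijk: "{i, j, k} = {1, 2, 3}" and p: "p > 0"
  shows "I_point k p \<in> I_curve k"
  unfolding I_curve_iff[OF ijk] unit_volume_iff[OF ijk] I_point_component[OF ijk]
  using p by (simp add: power2_eq_square)

lemma I_curve_inter_s_curve_other:
  assumes ijk: "{i, j, k} = {1, 2, 3}"
  shows "I_curve k \<inter> s_curve i = {}"
proof -
  have "gamma_poly i x > 0" if "x \<in> I_curve k" for x
  proof -
    have pos: "x $ j > 0" "x $ k > 0" and eq: "x $ i = x $ j"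
      using that unfolding I_curve_iff[OF ijk] unit_volume_iff[OF ijk] by auto
    have "gamma_poly i x = (x $ k)^2"
      unfolding gamma_poly_eq[OF ijk] eq by (simp add: power2_eq_square algebra_simps)
    thus ?thesis using pos by simp
  qed
  thus ?thesis by (force simp: s_curve_def Gamma_set_def)
qed

lemma I_curve_inter_s_curve_same:
  assumes ijk: "{i, j, k} = {1, 2, 3}"
  shows "I_curve k \<inter> s_curve k = {I_point k (root 3 6 / 2)}"
proof -
  have p0: "root 3 6 / 2 > (0::real)" "(root 3 6 / 2 :: real)^3 = 3/4"
    by (auto simp: power_divide)
  have iff: "I_point k p \<in> s_curve k \<longleftrightarrow> p = root 3 6 / 2" if p: "p > 0" for p
  proof -
    have u: "I_point k p \<in> unit_volume" "I_point k p \<in> metrics"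
      using I_point_in_I_curve[OF ijk p] by (auto simp: I_curve_def unit_volume_def)
    have "gamma_poly k (I_point k p) = 4 / p - 3 / p^4"
      unfolding gamma_poly_eq[OF index_permute(4)[OF ijk]] I_point_component[OF ijk]
      using p by (simp add: field_simps power2_eq_square power4_eq_xxxx)
    also have "\<dots> = 0 \<longleftrightarrow> p^3 = (root 3 6 / 2)^3"
      unfolding p0(2) using p by (auto simp: field_simps power4_eq_xxxx power3_eq_cube)
    also have "\<dots> \<longleftrightarrow> p = root 3 6 / 2"
      using p p0(1) by (intro power_eq_iff_eq_base) auto
    finally show ?thesis using u by (simp add: s_curve_def Gamma_set_def)
  qed
  show ?thesis
  proof (intro equalityI subsetI)
    fix x assume "x \<in> I_curve k \<inter> s_curve k"
    then obtain p where "p > 0" "x = I_point k p" "x \<in> s_curve k" by (auto simp: I_curve_def)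
    moreover from this have "p = root 3 6 / 2" using iff by blast
    ultimately show "x \<in> {I_point k (root 3 6 / 2)}" by blast
  qed (use iff[OF p0(1)] I_point_in_I_curve[OF ijk p0(1)] in auto)
qed

text \<open>The comparison point on \<open>s\<^sub>i\<close> has ratio \<open>x\<^sub>k / x\<^sub>j = p\<^sup>-\<^sup>3\<close>, the same as the point of \<open>I\<^sub>k\<close>.  For
  such small \<open>t\<close> the ratio \<open>x\<^sub>i / x\<^sub>j = top_ratio t\<close> lies between \<open>1\<close> and \<open>1 + t / 3\<close>, so the unit volume
  condition forces \<open>x\<^sub>j\<close> and \<open>x\<^sub>i\<close> to be within \<open>1 / p\<^sup>2\<close> of \<open>p\<close>.\<close>

lemma infdist_I_point_s_curve_le:
  assumes ijk: "{i, j, k} = {1, 2, 3}" and p: "p \<ge> 1"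
  shows "infdist (I_point k p) (s_curve i) \<le> 3 / p^2"
proof -
  note kji = index_permute(5)[OF ijk]
  define t where "t = 1 / p^3"
  have t: "0 < t" "t \<le> 1" and tp: "t * p^3 = 1" using p by (auto simp: t_def)
  define y where "y = s_param k j t"
  define w where "w = alpha t"
  note y = s_param_component[OF kji t(1), folded y_def w_def]
  have w: "w > 0" using alpha_pos[OF t(1)] by (simp add: w_def)
  have K1: "top_ratio t \<ge> 1"
  proof -
    have "(2 * disc_root t)^2 = (2 - t)^2 + 3 * t^2" using disc_root_sq[of t] by algebra
    hence "(2 - t)^2 \<le> (2 * disc_root t)^2" by simp
    hence "2 - t \<le> 2 * disc_root t"
      by (rule power2_le_imp_le) (use disc_root_pos[of t] in simp)
    thus ?thesis by (simp add: top_ratio_def)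
  qed
  have K2: "top_ratio t \<le> 1 + t / 3"
  proof -
    have "(disc_root t)^2 \<le> 1^2"
      using disc_root_sq[of t] t mult_left_le[of t t] by (simp add: power2_eq_square)
    hence "disc_root t \<le> 1" by (rule power2_le_imp_le) simp
    thus ?thesis by (simp add: top_ratio_def)
  qed
  have "t * (top_ratio t * w^3) = t * p^3"
    using alpha_cube[OF t(1)] tp by (simp add: w_def mult_ac)
  hence cube: "top_ratio t * w^3 = p^3" using t by simp
  have "1 * w^3 \<le> top_ratio t * w^3" using K1 w by (intro mult_right_mono) auto
  hence wp: "w \<le> p" using cube p by (simp add: power_mono_iff[of w p 3] w less_imp_le)
  have "p^3 - w^3 \<le> 1/3"
  proof -
    have "p^3 - w^3 = (top_ratio t - 1) * w^3" using cube by (simp add: algebra_simps)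
    also have "\<dots> \<le> (t / 3) * p^3"
      using K1 K2 w wp t by (intro mult_mono power_mono) auto
    also have "\<dots> = 1/3" using tp by simp
    finally show ?thesis .
  qed
  moreover have "(p - w) * p^2 \<le> p^3 - w^3"
  proof -
    have "p^3 - w^3 = (p - w) * (p^2 + p * w + w^2)"
      by (simp add: power2_eq_square power3_eq_cube algebra_simps)
    moreover have "(p - w) * p^2 \<le> (p - w) * (p^2 + p * w + w^2)"
      using wp w p by (intro mult_left_mono) auto
    ultimately show ?thesis by simp
  qed
  ultimately have "(p - w) * p^2 \<le> 1" by simp
  hence dj: "\<bar>p - w\<bar> \<le> 1 / p^2" using p wp by (simp add: field_simps)
  have "w * top_ratio t - w \<le> 1 / p^2"
  proof -
    have "w * top_ratio t - w = w * (top_ratio t - 1)" by (simp add: algebra_simps)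
    also have "\<dots> \<le> p * (t / 3)" using wp w K1 K2 p by (intro mult_mono) auto
    also have "\<dots> \<le> 1 / p^2" using p by (simp add: t_def field_simps power2_eq_square power3_eq_cube)
    finally show ?thesis .
  qed
  moreover have "w * top_ratio t \<ge> w" using w K1 by simp
  ultimately have di: "\<bar>p - w * top_ratio t\<bar> \<le> 1 / p^2" using dj wp by linarith
  have "t * w \<le> t * p" using wp t by simp
  also have "\<dots> = 1 / p^2" using p by (simp add: t_def field_simps power2_eq_square power3_eq_cube)
  finally have dk: "\<bar>1 / p^2 - t * w\<bar> \<le> 1 / p^2"
    using t w by (smt (verit) mult_pos_pos)
  have "dist (I_point k p) y \<le> (\<Sum>m\<in>UNIV. \<bar>(I_point k p - y) $ m\<bar>)"
    unfolding dist_norm by (rule norm_le_l1_cart)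
  also have "\<dots> \<le> 3 / p^2"
    unfolding index_univ[OF ijk] using index_distinct[OF ijk] di dj dk
    by (simp add: I_point_component[OF ijk] y)
  finally have "dist (I_point k p) y \<le> 3 / p^2" .
  moreover have "y \<in> s_curve i" unfolding y_def by (rule s_param_in_s_curve[OF kji t(1)])
  ultimately show ?thesis by (rule infdist_le2[rotated])
qed

lemma infdist_I_point_s_curve_tendsto_0:
  assumes ijk: "{i, j, k} = {1, 2, 3}"
  shows "((\<lambda>p. infdist (I_point k p) (s_curve i)) \<longlongrightarrow> 0) at_top"
proof (rule tendsto_sandwich[OF _ _ tendsto_const])
  show "eventually (\<lambda>p. 0 \<le> infdist (I_point k p) (s_curve i)) at_top"
    by (simp add: infdist_nonneg)
  show "eventually (\<lambda>p. infdist (I_point k p) (s_curve i) \<le> 3 / p^2) at_top"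
    using eventually_ge_at_top[of 1]
    by eventually_elim (rule infdist_I_point_s_curve_le[OF ijk])
  show "((\<lambda>p::real. 3 / p^2) \<longlongrightarrow> 0) at_top"
    by (intro tendsto_divide_0[OF tendsto_const] filterlim_at_top_imp_at_infinity
        filterlim_pow_at_top filterlim_ident) auto
qed

theorem theorem1:
  fixes a :: real and i j k :: 3
  assumes "a \<in> {1/6, 1/8, 1/9}"
    and "{i, j, k} = {1, 2, 3}"
  shows
    "(top_of_set unit_volume) frontier_of unit_volume_pos_curv
        = s_curve 1 \<union> s_curve 2 \<union> s_curve 3 \<and>
     disjoint_family s_curve \<and>
     regular_curve (s_curve k) \<and>
     connected (s_curve k) \<and>
     (\<forall>t>0. alpha t > 0) \<and>
     isCont alpha 1 \<and>
     regular_parametrization (s_param i j) {0<..} (s_curve k) \<and>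
     ricci_invariant a (I_curve k) \<and>
     I_curve k \<inter> s_curve k = {I_point k (root 3 6 / 2)} \<and>
     I_curve k \<inter> s_curve i = {} \<and>
     I_curve k \<inter> s_curve j = {} \<and>
     ((\<lambda>p. infdist (I_point k p) (s_curve i)) \<longlongrightarrow> 0) at_top \<and>
     ((\<lambda>p. infdist (I_point k p) (s_curve j)) \<longlongrightarrow> 0) at_top"
proof -
  note ijk = assms(2) and jik = index_permute(2)[OF assms(2)]
  have "(\<Union>m. s_curve m) = s_curve 1 \<union> s_curve 2 \<union> s_curve 3"
    by (auto simp: UNIV_3)
  hence "(top_of_set unit_volume) frontier_of unit_volume_pos_curv
      = s_curve 1 \<union> s_curve 2 \<union> s_curve 3"
    using frontier_unit_volume_pos_curv by simp
  thus ?thesis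
    by (intro conjI allI impI)
      (assumption
        | rule disjoint_s_curves regular_curve_s_curve[OF ijk] connected_s_curve[OF ijk]
            alpha_pos isCont_alpha zero_less_one regular_parametrization_s_param[OF ijk]
            ricci_invariant_I_curve[OF ijk] I_curve_inter_s_curve_same[OF ijk]
            I_curve_inter_s_curve_other[OF ijk] I_curve_inter_s_curve_other[OF jik]
            infdist_I_point_s_curve_tendsto_0[OF ijk] infdist_I_point_s_curve_tendsto_0[OF jik])+
qed

end
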